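(* Let $p$ be a prime and let $G$ be a finite $p$-group of nilpotency class at most $p-1$. Then for every integer $c\geq 1$, $\exp(M^{(c)}(G))$ divides $\exp(G)$. In particular, $\exp(M(G))$ divides $\exp(G)$.
   Context: For a group $G$ presented as a quotient $G\cong F/R$ of a free group $F$ by a normal subgroup $R$, and an integer $c\geq 1$, the $c$-nilpotent multiplier of $G$ is $M^{(c)}(G)=\dfrac{R\cap\gamma_{c+1}(F)}{[R,\,{}_cF]}$, where $\gamma_i(F)$ denotes the $i$-th term of the lower central series of $F$ (with $\gamma_1(F)=F$) and $[R,\,{}_cF]$ denotes the left-normed commutator subgroup $[R,F,\dots,F]$ with $c$ copies of $F$, i.e. $[R,\,{}_1F]=[R,F]$ and $[R,\,{}_{i+1}F]=[[R,\,{}_iF],F]$. Up to isomorphism, $M^{(c)}(G)$ does not depend on the chosen free presentation. The case $c=1$ is the Schur multiplier $M(G)=M^{(1)}(G)$. For a group $H$, $\exp(H)$ denotes the exponent of $H$: the least positive integer $n$ with $h^n=1$ for all $h\in H$. *)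

theory Defs
  imports "HOL-Algebra.Algebra" "HOL-Computational_Algebra.Primes"
begin

section \<open>Free groups\<close>

text \<open>
  A letter \<open>(x, True)\<close> stands for the generator \<open>x\<close>, and \<open>(x, False)\<close> for its formal inverse.
  The free group on \<open>S\<close> consists of the reduced words over \<open>S\<close>, multiplied by
  concatenation followed by free reduction.
\<close>

definition reduced_word :: "('a \<times> bool) list \<Rightarrow> bool" where
  "reduced_word w \<longleftrightarrow> successively (\<lambda>l m. \<not> (fst l = fst m \<and> snd l \<noteq> snd m)) w"

fun cons_reduce :: "'a \<times> bool \<Rightarrow> ('a \<times> bool) list \<Rightarrow> ('a \<times> bool) list" where
  "cons_reduce l [] = [l]"
| "cons_reduce l (m # w) = (if fst l = fst m \<and> snd l \<noteq> snd m then w else l # m # w)"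

definition free_reduce :: "('a \<times> bool) list \<Rightarrow> ('a \<times> bool) list" where
  "free_reduce w = foldr cons_reduce w []"

definition free_group :: "'a set \<Rightarrow> ('a \<times> bool) list monoid" where
  "free_group S =
     \<lparr>carrier = {w \<in> lists (S \<times> UNIV). reduced_word w},
      monoid.mult = (\<lambda>u v. free_reduce (u @ v)),
      one = []\<rparr>"

lemma reduced_cons_reduce: "reduced_word w \<Longrightarrow> reduced_word (cons_reduce l w)"
  by (cases w) (auto simp: reduced_word_def successively_Cons)

lemma cons_reduce_cancel:
  assumes "reduced_word w" "fst l = fst m" "snd l \<noteq> snd m"
  shows "cons_reduce l (cons_reduce m w) = w"
proof (cases w)
  case Nil
  then show ?thesis using assms by auto
next
  case (Cons n v)
  show ?thesis
  proof (cases "fst m = fst n \<and> snd m \<noteq> snd n")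
    case True
    then have "l = n" using assms by (auto simp: prod_eq_iff)
    moreover have "cons_reduce n v = n # v"
      using assms(1) Cons by (cases v) (auto simp: reduced_word_def)
    ultimately show ?thesis using True Cons by auto
  next
    case False
    then show ?thesis using assms Cons by auto
  qed
qed

lemma reduced_foldr: "reduced_word z \<Longrightarrow> reduced_word (foldr cons_reduce w z)"
  by (induction w) (auto intro: reduced_cons_reduce)

lemma reduced_free_reduce: "reduced_word (free_reduce w)"
  unfolding free_reduce_def by (rule reduced_foldr) (simp add: reduced_word_def)

lemma foldr_cons_reduce:
  assumes "reduced_word z"
  shows "foldr cons_reduce (cons_reduce l v) z = cons_reduce l (foldr cons_reduce v z)"
  using assms by (cases v) (auto simp: cons_reduce_cancel reduced_foldr)

lemma foldr_free_reduce:
  assumes "reduced_word z"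
  shows "foldr cons_reduce (free_reduce v) z = foldr cons_reduce v z"
  unfolding free_reduce_def
  by (induction v) (auto simp: foldr_cons_reduce[OF assms])

lemma free_reduce_append_left: "free_reduce (free_reduce u @ v) = free_reduce (u @ v)"
  using foldr_free_reduce[of "foldr cons_reduce v []" u] reduced_free_reduce[of v]
  by (simp add: free_reduce_def)

lemma free_reduce_append_right: "free_reduce (u @ free_reduce v) = free_reduce (u @ v)"
  using foldr_free_reduce[of "[]" v]
  by (simp add: free_reduce_def reduced_word_def)

lemma free_reduce_id: "reduced_word w \<Longrightarrow> free_reduce w = w"
proof (induction w)
  case (Cons l w)
  then have "reduced_word w"
    by (auto simp: reduced_word_def successively_Cons)
  then have "free_reduce (l # w) = cons_reduce l w"
    using Cons.IH by (simp add: free_reduce_def)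
  also have "\<dots> = l # w"
    using Cons.prems by (cases w) (auto simp: reduced_word_def)
  finally show ?case .
qed (simp add: free_reduce_def)

lemma cons_reduce_in_lists: "l \<in> A \<Longrightarrow> w \<in> lists A \<Longrightarrow> cons_reduce l w \<in> lists A"
  by (cases w) auto

lemma free_reduce_in_lists: "w \<in> lists A \<Longrightarrow> free_reduce w \<in> lists A"
proof (induction w)
  case (Cons l w)
  then show ?case
    using cons_reduce_in_lists[of l A "free_reduce w"] by (simp add: free_reduce_def)
qed (simp add: free_reduce_def)

lemma free_reduce_inverse_word:
  "free_reduce (rev (map (apsnd Not) w) @ w) = []"
proof (induction w)
  case (Cons l w)
  have "free_reduce (rev (map (apsnd Not) (l # w)) @ l # w) =
        foldr cons_reduce (rev (map (apsnd Not) w))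
          (cons_reduce (apsnd Not l) (cons_reduce l (free_reduce w)))"
    by (simp add: free_reduce_def)
  also have "\<dots> = foldr cons_reduce (rev (map (apsnd Not) w)) (free_reduce w)"
    by (subst cons_reduce_cancel) (auto simp: reduced_free_reduce)
  finally show ?case using Cons.IH by (simp add: free_reduce_def)
qed (simp add: free_reduce_def)

lemma group_free_group: "group (free_group S)"
proof (rule groupI)
  fix w assume w: "w \<in> carrier (free_group S)"
  let ?v = "free_reduce (rev (map (apsnd Not) w))"
  have "rev (map (apsnd Not) w) \<in> lists (S \<times> UNIV)"
    using w by (fastforce simp: free_group_def in_lists_conv_set)
  then have "?v \<in> carrier (free_group S)"
    unfolding free_group_def using free_reduce_in_lists reduced_free_reduce by auto
  moreover have "?v \<otimes>\<^bsub>free_group S\<^esub> w = \<one>\<^bsub>free_group S\<^esub>"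
    by (simp add: free_group_def free_reduce_append_left free_reduce_inverse_word)
  ultimately show "\<exists>v\<in>carrier (free_group S). v \<otimes>\<^bsub>free_group S\<^esub> w = \<one>\<^bsub>free_group S\<^esub>"
    by blast
next
  fix u v assume "u \<in> carrier (free_group S)" "v \<in> carrier (free_group S)"
  then show "u \<otimes>\<^bsub>free_group S\<^esub> v \<in> carrier (free_group S)"
    using free_reduce_in_lists[of "u @ v" "S \<times> UNIV"] reduced_free_reduce[of "u @ v"]
    by (simp add: free_group_def)
qed (auto simp: free_group_def free_reduce_append_left free_reduce_append_right
        free_reduce_id, auto simp: reduced_word_def)

definition word_eval :: "('b, 'c) monoid_scheme \<Rightarrow> ('a \<Rightarrow> 'b) \<Rightarrow> ('a \<times> bool) list \<Rightarrow> 'b" where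
  "word_eval H f w =
     foldr (\<lambda>l h. (if snd l then f (fst l) else inv\<^bsub>H\<^esub> f (fst l)) \<otimes>\<^bsub>H\<^esub> h) w \<one>\<^bsub>H\<^esub>"

text \<open>The universal property of the free group: existence and uniqueness of the extension.\<close>

lemma (in group) free_group_extension:
  assumes f: "f \<in> S \<rightarrow> carrier G"
  shows "word_eval G f \<in> hom (free_group S) G"
    and "\<And>x. x \<in> S \<Longrightarrow> word_eval G f [(x, True)] = f x"
proof -
  let ?e = "word_eval G f"
  let ?g = "\<lambda>l. if snd l then f (fst l) else inv f (fst l)"
  have e_Cons: "?e (l # w) = ?g l \<otimes> ?e w" and e_Nil: "?e [] = \<one>" for l w
    by (simp_all add: word_eval_def)
  have g: "?g l \<in> carrier G" if "l \<in> S \<times> UNIV" for l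
    using that f by (auto simp: Pi_iff)
  have closed: "?e w \<in> carrier G" if "w \<in> lists (S \<times> UNIV)" for w
    using that
  proof (induction w)
    case (Cons l w)
    then show ?case using g[of l] by (simp add: e_Cons del: in_lists_conv_set)
  qed (simp add: e_Nil)
  have step: "?e (cons_reduce l w) = ?g l \<otimes> ?e w"
    if "l \<in> S \<times> UNIV" "w \<in> lists (S \<times> UNIV)" for l w
  proof (cases w)
    case (Cons m v)
    have mv: "m \<in> S \<times> UNIV" "v \<in> lists (S \<times> UNIV)" using that Cons by auto
    show ?thesis
    proof (cases "fst l = fst m \<and> snd l \<noteq> snd m")
      case True
      then have "?g l \<otimes> ?g m = \<one>" using mv f by (auto simp: Pi_iff)
      then have "?g l \<otimes> (?g m \<otimes> ?e v) = ?e v"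
        using g[OF mv(1)] g[OF that(1)] closed[OF mv(2)] by (simp add: m_assoc[symmetric] del: if_split)
      then show ?thesis using True Cons e_Cons by simp
    next
      case False
      then have "cons_reduce l w = l # w" using Cons by auto
      then show ?thesis by (simp add: e_Cons)
    qed
  qed (simp add: e_Cons)
  have red: "?e (free_reduce w) = ?e w" if "w \<in> lists (S \<times> UNIV)" for w
    using that
  proof (induction w)
    case (Cons l w)
    have "?e (free_reduce (l # w)) = ?e (cons_reduce l (free_reduce w))"
      by (simp add: free_reduce_def)
    also have "\<dots> = ?g l \<otimes> ?e (free_reduce w)"
      using Cons.hyps by (intro step free_reduce_in_lists) auto
    finally show ?case
      using Cons by (simp only: e_Cons)
  qed (simp add: free_reduce_def)
  have app: "?e (u @ v) = ?e u \<otimes> ?e v"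
    if "u \<in> lists (S \<times> UNIV)" "v \<in> lists (S \<times> UNIV)" for u v
    using that(1)
  proof (induction u)
    case (Cons l u)
    then show ?case
      using g[OF Cons.hyps(1)] closed[OF Cons.hyps(2)] closed[OF that(2)]
      by (simp only: append_Cons e_Cons m_assoc)
  qed (use closed[OF that(2)] in \<open>simp add: e_Nil\<close>)
  show "?e \<in> hom (free_group S) G"
  proof (rule homI)
    fix u v assume "u \<in> carrier (free_group S)" "v \<in> carrier (free_group S)"
    then have "u \<in> lists (S \<times> UNIV)" "v \<in> lists (S \<times> UNIV)"
      by (auto simp: free_group_def)
    then show "?e (u \<otimes>\<^bsub>free_group S\<^esub> v) = ?e u \<otimes> ?e v"
      using red[of "u @ v"] app[of u v] by (simp add: free_group_def)
  qed (auto simp: free_group_def intro!: closed)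
  show "?e [(x, True)] = f x" if "x \<in> S" for x
    using that f by (auto simp: word_eval_def Pi_iff)
qed

lemma (in group) free_group_extension_unique:
  assumes h: "h \<in> hom (free_group S) G" and h': "h' \<in> hom (free_group S) G"
    and eq: "\<And>x. x \<in> S \<Longrightarrow> h [(x, True)] = h' [(x, True)]"
    and w: "w \<in> carrier (free_group S)"
  shows "h w = h' w"
proof -
  interpret F: group "free_group S" by (rule group_free_group)
  interpret h: group_hom "free_group S" G h by unfold_locales (rule h)
  interpret h': group_hom "free_group S" G h' by unfold_locales (rule h')
  have letter: "[l] \<in> carrier (free_group S)" if "l \<in> S \<times> UNIV" for l
    using that by (auto simp: free_group_def reduced_word_def)
  have eq_letter: "h [l] = h' [l]" if l_in: "l \<in> S \<times> UNIV" for l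
  proof (cases "snd l")
    case True
    then show ?thesis using that eq by (cases l) auto
  next
    case False
    then obtain x where l: "l = (x, False)" "x \<in> S" using l_in by (cases l) auto
    then have "[l] \<otimes>\<^bsub>free_group S\<^esub> [(x, True)] = \<one>\<^bsub>free_group S\<^esub>"
      by (simp add: free_group_def free_reduce_def)
    then have "[l] = inv\<^bsub>free_group S\<^esub> [(x, True)]"
      using F.inv_equality[of "[l]" "[(x, True)]"] letter l by auto
    then show ?thesis using letter[of "(x, True)"] l eq by simp
  qed
  have "w \<in> lists (S \<times> UNIV)" "reduced_word w" using w by (auto simp: free_group_def)
  then show ?thesis
  proof (induction w)
    case Nil
    then show ?case using h.hom_one h'.hom_one by (simp add: free_group_def)
  next
    case (Cons l w)
    then have "reduced_word w" by (auto simp: reduced_word_def successively_Cons)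
    then have w: "w \<in> carrier (free_group S)" using Cons by (auto simp: free_group_def)
    have "l # w = [l] \<otimes>\<^bsub>free_group S\<^esub> w"
      using free_reduce_id[OF Cons.prems] by (simp add: free_group_def)
    then show ?case
      using Cons w eq_letter[OF Cons.hyps(1)] letter[OF Cons.hyps(1)] \<open>reduced_word w\<close> by simp
  qed
qed

definition is_free_group :: "('a, 'b) monoid_scheme \<Rightarrow> bool" where
  "is_free_group F \<longleftrightarrow> group F \<and> (\<exists>S :: 'a set. free_group S \<cong> F)"
  \<comment> \<open>Up to isomorphism the basis is a subset of \<open>F\<close>, so generators of type \<open>'a\<close> suffice.\<close>


section \<open>Commutator subgroups and the lower central series\<close>

definition commutator_subgroup :: "('a, 'b) monoid_scheme \<Rightarrow> 'a set \<Rightarrow> 'a set \<Rightarrow> 'a set" where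
  "commutator_subgroup G H K =
     generate G (\<Union>h\<in>H. \<Union>k\<in>K. {h \<otimes>\<^bsub>G\<^esub> k \<otimes>\<^bsub>G\<^esub> inv\<^bsub>G\<^esub> h \<otimes>\<^bsub>G\<^esub> inv\<^bsub>G\<^esub> k})"

lemma commutator_subgroup_self: "commutator_subgroup G H H = derived G H"
  by (simp add: commutator_subgroup_def derived_def)

text \<open>\<open>iter_commutator G R c\<close> is the left-normed \<open>[R, G, \<dots>, G]\<close> with \<open>c\<close> copies of \<open>G\<close>.\<close>

primrec iter_commutator :: "('a, 'b) monoid_scheme \<Rightarrow> 'a set \<Rightarrow> nat \<Rightarrow> 'a set" where
  "iter_commutator G R 0 = R"
| "iter_commutator G R (Suc c) = commutator_subgroup G (iter_commutator G R c) (carrier G)"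

text \<open>The series is indexed from 1; index 0 is a dummy with the same value as index 1.\<close>

definition lower_central :: "('a, 'b) monoid_scheme \<Rightarrow> nat \<Rightarrow> 'a set" where
  "lower_central G i = iter_commutator G (carrier G) (i - 1)"

lemma lower_central_1: "lower_central G 1 = carrier G"
  by (simp add: lower_central_def)

lemma lower_central_Suc:
  "i \<ge> 1 \<Longrightarrow> lower_central G (Suc i) = commutator_subgroup G (lower_central G i) (carrier G)"
  by (cases i) (auto simp: lower_central_def)

definition nilpotent_group :: "('a, 'b) monoid_scheme \<Rightarrow> bool" where
  "nilpotent_group G \<longleftrightarrow> group G \<and> (\<exists>k. lower_central G (k + 1) = {\<one>\<^bsub>G\<^esub>})"

definition nilpotency_class :: "('a, 'b) monoid_scheme \<Rightarrow> nat" where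
  "nilpotency_class G = (LEAST k. lower_central G (k + 1) = {\<one>\<^bsub>G\<^esub>})"


section \<open>Finite p-groups and exponents\<close>

definition finite_p_group :: "nat \<Rightarrow> ('a, 'b) monoid_scheme \<Rightarrow> bool" where
  "finite_p_group p G \<longleftrightarrow> group G \<and> finite (carrier G) \<and> (\<exists>n. order G = p ^ n)"

text \<open>
  A group of infinite exponent gets exponent 0. Hence a divisibility
  \<open>group_exponent H dvd n\<close> with \<open>n > 0\<close> includes the claim that \<open>H\<close> has finite exponent.
\<close>

definition group_exponent :: "('a, 'b) monoid_scheme \<Rightarrow> nat" where
  "group_exponent H =
     (if \<exists>n::nat. n > 0 \<and> (\<forall>h\<in>carrier H. h [^]\<^bsub>H\<^esub> n = \<one>\<^bsub>H\<^esub>)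
      then LEAST n::nat. n > 0 \<and> (\<forall>h\<in>carrier H. h [^]\<^bsub>H\<^esub> n = \<one>\<^bsub>H\<^esub>)
      else 0)"


section \<open>Free presentations and nilpotent multipliers\<close>

definition free_presentation ::
    "('f, 'c) monoid_scheme \<Rightarrow> 'f set \<Rightarrow> ('a, 'b) monoid_scheme \<Rightarrow> bool" where
  "free_presentation F R G \<longleftrightarrow> is_free_group F \<and> R \<lhd> F \<and> (F Mod R) \<cong> G"

text \<open>
  The \<open>c\<close>-nilpotent multiplier of \<open>F/R\<close>, computed from the free presentation \<open>F/R\<close>. The
  multiplier of \<open>G\<close> is this group for any free presentation of \<open>G\<close>, up to isomorphism.
\<close>

definition nilpotent_multiplier ::
    "('f, 'c) monoid_scheme \<Rightarrow> 'f set \<Rightarrow> nat \<Rightarrow> 'f set monoid" where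
  "nilpotent_multiplier F R c =
     (F\<lparr>carrier := R \<inter> lower_central F (c + 1)\<rparr>) Mod (iter_commutator F R c)"

definition schur_multiplier :: "('f, 'c) monoid_scheme \<Rightarrow> 'f set \<Rightarrow> 'f set monoid" where
  "schur_multiplier F R = nilpotent_multiplier F R 1"

end

theory Submission
  imports Defs
begin

text \<open>
  Let \<open>e = exp(G)\<close>, a power of \<open>p\<close>, and \<open>G = F/R\<close>. Write \<open>\<gamma>\<^sub>i\<close> for the lower central series of \<open>F\<close>
  and \<open>R\<^sub>m = [R, F, \<dots>, F]\<close> with \<open>m\<close> copies of \<open>F\<close>. The hypotheses say that \<open>x\<^sup>e \<in> R\<close> for all \<open>x\<close>
  and that \<open>\<gamma>\<^sub>p \<subseteq> R\<close>, whence \<open>\<gamma>\<^bsub>p+m\<^esub> \<subseteq> R\<^sub>m\<close>. The theorem follows from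

    \<^item> \<open>w\<^sup>e \<in> R\<^sub>m\<close> whenever \<open>w \<in> \<gamma>\<^sub>n\<close> and \<open>n > m\<close> (\<open>lower_central_pow_in_iter_commutator\<close>)

  at \<open>m = c\<close>, \<open>n = c + 1\<close>.

  The claim is proved by induction on \<open>m\<close> and, for fixed \<open>m\<close>, by downward induction on \<open>n\<close>,
  starting from the terms \<open>\<gamma>\<^sub>n \<subseteq> R\<^sub>m\<close> deep in the series. Suppose that it holds for \<open>m\<close>, and let \<open>n > m + 1\<close>.
  For a generator \<open>b = [v, y]\<close> of \<open>\<gamma>\<^sub>n\<close>, with \<open>v \<in> \<gamma>\<^bsub>n-1\<^esub>\<close>, put \<open>u = v\<^sup>-\<^sup>1\<close>; then \<open>ub = y u y\<^sup>-\<^sup>1\<close>.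
  The Hall--Petrescu formula writes \<open>(ub)\<^sup>e\<close> as \<open>u\<^sup>e b\<^sup>e\<close> times powers \<open>c\<^sub>i\<close> to the \<open>e choose i\<close>, where
  \<open>i \<ge> 2\<close> and \<open>c\<^sub>i \<in> \<gamma>\<^bsub>n-1+i\<^esub>\<close>. If \<open>i < p\<close> then \<open>e\<close> divides \<open>e choose i\<close> and the factor lies in
  \<open>R\<^bsub>m+1\<^esub>\<close> by the downward induction; if \<open>i \<ge> p\<close> then \<open>c\<^sub>i \<in> \<gamma>\<^bsub>p+m+1\<^esub> \<subseteq> R\<^bsub>m+1\<^esub>\<close> already. So modulo
  \<open>R\<^bsub>m+1\<^esub>\<close> the element \<open>b\<^sup>e\<close> equals \<open>u\<^sup>-\<^sup>e y u\<^sup>e y\<^sup>-\<^sup>1 = [u\<^sup>-\<^sup>e, y]\<close>, and this lies in \<open>R\<^bsub>m+1\<^esub> = [R\<^sub>m, F]\<close>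
  because \<open>u\<^sup>e \<in> R\<^sub>m\<close>. The same formula passes from the generators to their products.

  The Hall--Petrescu formula is obtained from the theorem of Lazard and Leibman that the polynomial
  sequences in a filtered group form a group: \<open>n \<mapsto> b\<^sup>-\<^sup>n a\<^sup>-\<^sup>n (ab)\<^sup>n\<close> is such a sequence, it is trivial
  at \<open>0\<close> and \<open>1\<close>, and so its Taylor expansion has only the factors with \<open>i \<ge> 2\<close>.
\<close>

section \<open>Commutators\<close>

definition (in group) commutator :: "'a \<Rightarrow> 'a \<Rightarrow> 'a" where
  "commutator x y = x \<otimes> y \<otimes> inv x \<otimes> inv y"

context group
begin

lemma commutator_closed [simp, intro]:
  "x \<in> carrier G \<Longrightarrow> y \<in> carrier G \<Longrightarrow> commutator x y \<in> carrier G"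
  by (simp add: commutator_def)

lemma cancel_left_inv [simp]:
  "x \<in> carrier G \<Longrightarrow> y \<in> carrier G \<Longrightarrow> inv x \<otimes> (x \<otimes> y) = y"
  "x \<in> carrier G \<Longrightarrow> y \<in> carrier G \<Longrightarrow> x \<otimes> (inv x \<otimes> y) = y"
  by (simp_all add: m_assoc[symmetric])

text \<open>
  With associativity and the two cancellation rules above these equations bring a group word into
  freely reduced form, so they decide identities that hold in every group.
\<close>

lemmas group_word_simps = commutator_def m_assoc inv_mult_group

lemma conj_nat_pow:
  assumes "x \<in> carrier G" "y \<in> carrier G"
  shows "(y \<otimes> x \<otimes> inv y) [^] (n::nat) = y \<otimes> x [^] n \<otimes> inv y"
proof (induction n)
  case (Suc n)
  then show ?case using assms by (simp add: m_assoc)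
qed (use assms in simp)

text \<open>
  The elements that commute with \<open>z\<close> modulo a normal subgroup form a subgroup, so commutator
  conditions need only be checked on generators.
\<close>

lemma commutator_generate_left:
  assumes M: "M \<lhd> G" and U: "U \<subseteq> carrier G" and z: "z \<in> carrier G"
    and comm: "\<And>x. x \<in> U \<Longrightarrow> commutator x z \<in> M"
    and x: "x \<in> generate G U"
  shows "commutator x z \<in> M"
proof -
  interpret M: normal M G by (rule M)
  note gen = generate_in_carrier[OF U]
  show ?thesis using x
  proof (induction x rule: generate.induct)
    case one
    then show ?case using z by (simp add: commutator_def)
  next
    case (incl h)
    then show ?case by (rule comm)
  next
    case (inv h)
    then have h: "h \<in> carrier G" using U by auto
    have "commutator (inv h) z = inv h \<otimes> inv (commutator h z) \<otimes> h"
      using h z by (simp add: group_word_simps)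
    then show ?case using M.inv_op_closed1[OF h] comm[OF inv] by simp
  next
    case (eng h k)
    then have h: "h \<in> carrier G" and k: "k \<in> carrier G" using gen by auto
    have "commutator (h \<otimes> k) z = (h \<otimes> commutator k z \<otimes> inv h) \<otimes> commutator h z"
      using h k z by (simp add: group_word_simps)
    then show ?case using M.inv_op_closed2[OF h eng.IH(2)] eng.IH(1) by simp
  qed
qed

lemma commutator_swap_in:
  assumes "subgroup M G" "x \<in> carrier G" "y \<in> carrier G" "commutator x y \<in> M"
  shows "commutator y x \<in> M"
proof -
  have "commutator y x = inv (commutator x y)"
    using assms by (simp add: group_word_simps)
  then show ?thesis using assms subgroup.m_inv_closed by metis
qed

lemma commutator_generate:
  assumes M: "M \<lhd> G" and U: "U \<subseteq> carrier G" and V: "V \<subseteq> carrier G"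
    and comm: "\<And>x y. x \<in> U \<Longrightarrow> y \<in> V \<Longrightarrow> commutator x y \<in> M"
    and x: "x \<in> generate G U" and y: "y \<in> generate G V"
  shows "commutator x y \<in> M"
proof -
  have sub: "subgroup M G" using M by (rule normal_imp_subgroup)
  have "commutator x' y \<in> M" if x': "x' \<in> U" for x'
  proof (rule commutator_swap_in[OF sub])
    show "commutator y x' \<in> M"
      using x' U V
      by (intro commutator_generate_left[OF M V _ _ y] commutator_swap_in[OF sub _ _ comm[OF x']]) auto
  qed (use x' U y generate_in_carrier[OF V] in auto)
  then show ?thesis
    by (rule commutator_generate_left[OF M U generate_in_carrier[OF V y] _ x])
qed

end


section \<open>Polynomial sequences in a filtered group\<close>

definition (in group) right_deriv :: "(nat \<Rightarrow> 'a) \<Rightarrow> nat \<Rightarrow> 'a" where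
  "right_deriv g n = inv (g n) \<otimes> g (Suc n)"

definition (in group) left_deriv :: "(nat \<Rightarrow> 'a) \<Rightarrow> nat \<Rightarrow> 'a" where
  "left_deriv g n = g (Suc n) \<otimes> inv (g n)"

text \<open>
  The filtration is stationary from \<open>N\<close> on, which gives downward inductions a start. \<open>A N\<close> may be
  nontrivial, so that one can compute modulo it without passing to a quotient. The commutator
  condition with \<open>j = 0\<close> makes every \<open>A i\<close> normal in \<open>A 0\<close>.
\<close>

locale group_filtration = group G for G (structure) +
  fixes A :: "nat \<Rightarrow> 'a set" and N :: nat
  assumes filt_subgroup: "subgroup (A i) G"
    and filt_Suc: "A (Suc i) \<subseteq> A i"
    and filt_commutator: "x \<in> A i \<Longrightarrow> y \<in> A j \<Longrightarrow> commutator x y \<in> A (i + j)"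
    and filt_stationary: "i \<ge> N \<Longrightarrow> A i = A N"
begin

lemma filt_antimono: "i \<le> j \<Longrightarrow> A j \<subseteq> A i"
  using lift_Suc_antimono_le[of A] filt_Suc by blast

lemma filt_carrier: "x \<in> A i \<Longrightarrow> x \<in> carrier G"
  using filt_subgroup subgroup.subset by blast

lemmas filt_mult = subgroup.m_closed[OF filt_subgroup]
  and filt_inv = subgroup.m_inv_closed[OF filt_subgroup]
  and filt_one = subgroup.one_closed[OF filt_subgroup]

lemma filt_conj:
  assumes x: "x \<in> A i" and y: "y \<in> A 0"
  shows "y \<otimes> x \<otimes> inv y \<in> A i" "inv y \<otimes> x \<otimes> y \<in> A i"
proof -
  have conj: "y \<otimes> x \<otimes> inv y \<in> A i" if y: "y \<in> A 0" for y
  proof -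
    have "y \<otimes> x \<otimes> inv y = commutator y x \<otimes> x"
      using filt_carrier[OF x] filt_carrier[OF y] by (simp add: group_word_simps)
    then show ?thesis using filt_commutator[OF y x] filt_mult x by simp
  qed
  show "y \<otimes> x \<otimes> inv y \<in> A i" by (rule conj[OF y])
  show "inv y \<otimes> x \<otimes> y \<in> A i" using conj[OF filt_inv[OF y]] filt_carrier[OF y] by simp
qed

text \<open>
  \<open>polyseq s g\<close> says that all \<open>i\<close>-fold derivatives of \<open>g\<close> have values in \<open>A (s + i)\<close>. Both the left
  and the right derivative are required: products and inverses are harmless for either kind, but the
  derivative of a commutator is manageable only on the right and that of \<open>h\<^sup>-\<^sup>1 g h\<close> only on the
  left. The other derivative is in each case a conjugate of the manageable one.
\<close>

coinductive polyseq :: "nat \<Rightarrow> (nat \<Rightarrow> 'a) \<Rightarrow> bool" where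
  polyseqI: "\<lbrakk>\<And>n. g n \<in> A s; polyseq (Suc s) (right_deriv g); polyseq (Suc s) (left_deriv g)\<rbrakk>
    \<Longrightarrow> polyseq s g"

lemma polyseq_val: "polyseq s g \<Longrightarrow> g n \<in> A s"
  and polyseq_right_deriv: "polyseq s g \<Longrightarrow> polyseq (Suc s) (right_deriv g)"
  and polyseq_left_deriv: "polyseq s g \<Longrightarrow> polyseq (Suc s) (left_deriv g)"
  by (auto elim: polyseq.cases)

lemma polyseq_closed: "polyseq s g \<Longrightarrow> g n \<in> carrier G"
  using polyseq_val filt_carrier by blast

lemma polyseq_Suc: "polyseq (Suc s) g \<Longrightarrow> polyseq s g"
proof (coinduction arbitrary: s g rule: polyseq.coinduct)
  case (polyseq s g)
  then show ?case
    using polyseq_val filt_Suc polyseq_right_deriv polyseq_left_deriv by blast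
qed

lemma polyseq_antimono: "i \<le> j \<Longrightarrow> polyseq j g \<Longrightarrow> polyseq i g"
  by (induction rule: inc_induct) (auto intro: polyseq_Suc)

lemma polyseq_stationary:
  assumes "s \<ge> N" "\<And>n. g n \<in> A N"
  shows "polyseq s g"
  using assms
proof (coinduction arbitrary: s g rule: polyseq.coinduct)
  case (polyseq s g)
  then have "right_deriv g n \<in> A N" "left_deriv g n \<in> A N" for n
    by (auto simp: right_deriv_def left_deriv_def intro: filt_mult filt_inv)
  then show ?case using polyseq filt_stationary[of s]
    by (metis le_SucI)
qed

text \<open>
  The sequences of level \<open>s\<close> form a group normalised by all polynomial sequences, and commutators add
  levels. These properties are bundled because they have to be proved together, by downward
  induction on \<open>s\<close>; conjugation is listed in both directions since \<open>h\<^sup>-\<^sup>1\<close> is known to be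
  polynomial only once the induction has reached level \<open>0\<close>.
\<close>

definition lazard_leibman :: "nat \<Rightarrow> bool" where
  "lazard_leibman s \<longleftrightarrow>
    (\<forall>g h. polyseq s g \<longrightarrow> polyseq s h \<longrightarrow> polyseq s (\<lambda>n. g n \<otimes> h n)) \<and>
    (\<forall>g. polyseq s g \<longrightarrow> polyseq s (\<lambda>n. inv (g n))) \<and>
    (\<forall>g h. polyseq s g \<longrightarrow> polyseq 0 h \<longrightarrow> polyseq s (\<lambda>n. h n \<otimes> g n \<otimes> inv (h n))) \<and>
    (\<forall>g h. polyseq s g \<longrightarrow> polyseq 0 h \<longrightarrow> polyseq s (\<lambda>n. inv (h n) \<otimes> g n \<otimes> h n)) \<and>
    (\<forall>i j g h. i + j = s \<longrightarrow> polyseq i g \<longrightarrow> polyseq j h \<longrightarrow>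
      polyseq s (\<lambda>n. commutator (g n) (h n)))"

lemma lazard_leibmanD:
  assumes "lazard_leibman s"
  shows "polyseq s g \<Longrightarrow> polyseq s h \<Longrightarrow> polyseq s (\<lambda>n. g n \<otimes> h n)"
    and "polyseq s g \<Longrightarrow> polyseq s (\<lambda>n. inv (g n))"
    and "polyseq s g \<Longrightarrow> polyseq 0 h \<Longrightarrow> polyseq s (\<lambda>n. h n \<otimes> g n \<otimes> inv (h n))"
    and "polyseq s g \<Longrightarrow> polyseq 0 h \<Longrightarrow> polyseq s (\<lambda>n. inv (h n) \<otimes> g n \<otimes> h n)"
    and "polyseq i g \<Longrightarrow> polyseq j h \<Longrightarrow> i + j = s \<Longrightarrow> polyseq s (\<lambda>n. commutator (g n) (h n))"
  using assms unfolding lazard_leibman_def by blast+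

lemma lazard_leibman_stationary:
  assumes s: "s \<ge> N"
  shows "lazard_leibman s"
  unfolding lazard_leibman_def
proof (intro conjI allI impI)
  have A: "A s = A N" using s by (rule filt_stationary)
  fix g assume g: "polyseq s g"
  have gA: "g n \<in> A N" for n using polyseq_val[OF g] A by simp
  show "polyseq s (\<lambda>n. inv (g n))"
    by (intro polyseq_stationary[OF s] filt_inv gA)
  fix h
  show "polyseq s (\<lambda>n. g n \<otimes> h n)" if "polyseq s h"
    using polyseq_val[OF that] A by (intro polyseq_stationary[OF s] filt_mult gA) simp
  show "polyseq s (\<lambda>n. h n \<otimes> g n \<otimes> inv (h n))" if "polyseq 0 h"
    using polyseq_val[OF that] by (intro polyseq_stationary[OF s] filt_conj gA)
  show "polyseq s (\<lambda>n. inv (h n) \<otimes> g n \<otimes> h n)" if "polyseq 0 h"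
    using polyseq_val[OF that] by (intro polyseq_stationary[OF s] filt_conj gA)
next
  fix i j g h assume "i + j = s" "polyseq i g" "polyseq j h"
  then show "polyseq s (\<lambda>n. commutator (g n) (h n))"
    using filt_commutator polyseq_val filt_stationary[OF s]
    by (intro polyseq_stationary[OF s]) blast
qed

text \<open>
  Every derivative below is a product of conjugates of sequences that have level \<open>s + 1\<close>. The key
  point is the right derivative of \<open>[g, h]\<close>. If \<open>x\<close> and \<open>y\<close> are the right derivatives of \<open>g\<close> and
  \<open>h\<close>, it is \<open>[g, h]\<^sup>-\<^sup>1 [g x, h y]\<close>. Modulo level \<open>s + 1\<close> the sequence \<open>x\<close> commutes with \<open>h\<close>
  and \<open>y\<close>, and \<open>y\<close> with \<open>g\<close>, so that \<open>[g x, h y]\<close> collapses to \<open>[g, h]\<close>.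
\<close>

lemma lazard_leibman_step:
  assumes IH: "lazard_leibman (Suc s)"
  shows "lazard_leibman s"
proof -
  note mult = lazard_leibmanD(1)[OF IH] and inv = lazard_leibmanD(2)[OF IH]
    and conj = lazard_leibmanD(3)[OF IH] and conj' = lazard_leibmanD(4)[OF IH]
    and comm = lazard_leibmanD(5)[OF IH]
  have poly0: "polyseq 0 g" if "polyseq i g" for i g
    using polyseq_antimono[OF _ that, of 0] by simp
  have mult_s: "polyseq s (\<lambda>n. g n \<otimes> h n)" if g: "polyseq s g" and h: "polyseq s h" for g h
  proof (rule polyseqI)
    note c = polyseq_closed[OF g] polyseq_closed[OF h]
    show "g n \<otimes> h n \<in> A s" for n using g h by (intro filt_mult polyseq_val)
    have "right_deriv (\<lambda>n. g n \<otimes> h n) =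
        (\<lambda>n. (inv (h n) \<otimes> right_deriv g n \<otimes> h n) \<otimes> right_deriv h n)"
      using c by (intro ext) (simp add: right_deriv_def group_word_simps)
    then show "polyseq (Suc s) (right_deriv (\<lambda>n. g n \<otimes> h n))"
      using g h by (simp only:) (intro mult conj' polyseq_right_deriv poly0[OF h])
    have "left_deriv (\<lambda>n. g n \<otimes> h n) =
        (\<lambda>n. left_deriv g n \<otimes> (g n \<otimes> left_deriv h n \<otimes> inv (g n)))"
      using c by (intro ext) (simp add: left_deriv_def group_word_simps)
    then show "polyseq (Suc s) (left_deriv (\<lambda>n. g n \<otimes> h n))"
      using g h by (simp only:) (intro mult conj polyseq_left_deriv poly0[OF g])
  qed
  have inv_s: "polyseq s (\<lambda>n. inv (g n))" if g: "polyseq s g" for g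
  proof (rule polyseqI)
    note c = polyseq_closed[OF g]
    show "inv (g n) \<in> A s" for n using g by (intro filt_inv polyseq_val)
    have "right_deriv (\<lambda>n. inv (g n)) = (\<lambda>n. inv (left_deriv g n))"
      "left_deriv (\<lambda>n. inv (g n)) = (\<lambda>n. inv (right_deriv g n))"
      using c by (auto intro!: ext simp: right_deriv_def left_deriv_def group_word_simps)
    then show "polyseq (Suc s) (right_deriv (\<lambda>n. inv (g n)))"
      "polyseq (Suc s) (left_deriv (\<lambda>n. inv (g n)))"
      using g by (simp_all only:) (intro inv polyseq_left_deriv polyseq_right_deriv; assumption)+
  qed
  have comm_s: "polyseq s (\<lambda>n. commutator (g n) (h n))"
    if ij: "i + j = s" and g: "polyseq i g" and h: "polyseq j h" for i j g h
  proof (rule polyseqI)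
    note c = polyseq_closed[OF g] polyseq_closed[OF h]
    note g0 = poly0[OF g] and h0 = poly0[OF h]
    let ?z = "\<lambda>n. commutator (g n) (h n)"
    let ?x = "right_deriv g" and ?y = "right_deriv h"
    note x = polyseq_right_deriv[OF g] and y = polyseq_right_deriv[OF h]
    show "?z n \<in> A s" for n using filt_commutator[OF polyseq_val[OF g] polyseq_val[OF h]] ij by simp
    have "right_deriv ?z = (\<lambda>n. h n \<otimes>
       ((g n \<otimes> ((inv (h n) \<otimes> commutator (?x n) (h n) \<otimes> h n) \<otimes> commutator (?x n) (?y n)) \<otimes> inv (g n))
         \<otimes> commutator (g n) (?y n)) \<otimes> inv (h n))"
      using c by (intro ext) (simp add: right_deriv_def group_word_simps)
    moreover have "polyseq (Suc s) \<dots>"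
      using ij
      by (intro conj conj' mult g0 h0 comm[OF x h] comm[OF x polyseq_Suc[OF y]] comm[OF g y]) auto
    ultimately show r: "polyseq (Suc s) (right_deriv ?z)" by simp
    have "left_deriv ?z = (\<lambda>n. g n \<otimes> (h n \<otimes> (inv (g n) \<otimes> (inv (h n) \<otimes> right_deriv ?z n \<otimes> h n)
        \<otimes> g n) \<otimes> inv (h n)) \<otimes> inv (g n))"
      using c by (intro ext) (simp add: right_deriv_def left_deriv_def group_word_simps)
    then show "polyseq (Suc s) (left_deriv ?z)"
      by (simp only:) (intro conj conj' g0 h0 r)
  qed
  have conj_s: "polyseq s (\<lambda>n. h n \<otimes> g n \<otimes> inv (h n))"
    if g: "polyseq s g" and h: "polyseq 0 h" for g h
  proof -
    have "(\<lambda>n. h n \<otimes> g n \<otimes> inv (h n)) = (\<lambda>n. commutator (h n) (g n) \<otimes> g n)"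
      using polyseq_closed[OF g] polyseq_closed[OF h] by (simp add: group_word_simps)
    moreover have "polyseq s \<dots>"
      by (intro mult_s g comm_s[OF _ h g]) simp
    ultimately show ?thesis by simp
  qed
  have conj'_s: "polyseq s (\<lambda>n. inv (h n) \<otimes> g n \<otimes> h n)"
    if g: "polyseq s g" and h: "polyseq 0 h" for g h
  proof (rule polyseqI)
    note c = polyseq_closed[OF g] polyseq_closed[OF h]
    note g0 = poly0[OF g]
    let ?z = "\<lambda>n. inv (h n) \<otimes> g n \<otimes> h n"
    let ?x = "left_deriv h" and ?v = "left_deriv g"
    note x = polyseq_left_deriv[OF h] and v = polyseq_left_deriv[OF g]
    show "?z n \<in> A s" for n using filt_conj polyseq_val g h by blast
    have "left_deriv ?z =
      (\<lambda>n. inv (h n) \<otimes> (inv (?x n) \<otimes> (?v n \<otimes> commutator (g n) (?x n)) \<otimes> ?x n) \<otimes> h n)"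
      using c by (intro ext) (simp add: left_deriv_def group_word_simps)
    moreover have "polyseq (Suc s) \<dots>"
      by (intro conj' mult h poly0[OF x] v comm[OF g x]) simp
    ultimately show l: "polyseq (Suc s) (left_deriv ?z)" by simp
    have "right_deriv ?z = (\<lambda>n. inv (h n) \<otimes> (inv (g n) \<otimes> (h n \<otimes> left_deriv ?z n \<otimes> inv (h n))
        \<otimes> g n) \<otimes> h n)"
      using c by (intro ext) (simp add: right_deriv_def left_deriv_def group_word_simps)
    then show "polyseq (Suc s) (right_deriv ?z)"
      by (simp only:) (intro conj conj' g0 h l)
  qed
  show ?thesis
    unfolding lazard_leibman_def using mult_s inv_s comm_s conj_s conj'_s by blast
qed

lemma polyseq_mult:
  assumes "polyseq s g" "polyseq s h"
  shows "polyseq s (\<lambda>n. g n \<otimes> h n)"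
proof -
  have "lazard_leibman s"
  proof (cases "s \<le> N")
    case True
    then show ?thesis
      by (induction rule: inc_induct) (auto intro: lazard_leibman_stationary lazard_leibman_step)
  qed (auto intro: lazard_leibman_stationary)
  then show ?thesis using assms by (rule lazard_leibmanD(1))
qed

lemma polyseq_one: "polyseq s (\<lambda>n. \<one>)"
proof (coinduction arbitrary: s rule: polyseq.coinduct)
  case polyseq
  then show ?case by (auto simp: filt_one right_deriv_def left_deriv_def)
qed

text \<open>By Pascal's rule, differentiating such a sequence lowers \<open>k\<close> by one.\<close>

lemma polyseq_binomial:
  assumes "a \<in> A (s + k)"
  shows "polyseq s (\<lambda>n. a [^] (n choose k))"
  using assms
proof (induction k arbitrary: s)
  case 0
  have a: "a \<in> carrier G" using 0 by (rule filt_carrier)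
  show ?case
  proof (rule polyseqI)
    show "a [^] (n choose 0) \<in> A s" for n using 0 a by simp
    have "right_deriv (\<lambda>n. a [^] (n choose 0)) = (\<lambda>n. \<one>)"
      "left_deriv (\<lambda>n. a [^] (n choose 0)) = (\<lambda>n. \<one>)"
      using a by (auto simp: right_deriv_def left_deriv_def)
    then show "polyseq (Suc s) (right_deriv (\<lambda>n. a [^] (n choose 0)))"
      "polyseq (Suc s) (left_deriv (\<lambda>n. a [^] (n choose 0)))"
      by (simp_all add: polyseq_one)
  qed
next
  case (Suc k)
  have a: "a \<in> carrier G" using Suc.prems by (rule filt_carrier)
  have as: "a \<in> A s" using Suc.prems filt_antimono[of s "s + Suc k"] by auto
  show ?case
  proof (rule polyseqI)
    have "a [^] (m::nat) \<in> A s" for m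
      by (induction m) (auto simp: as filt_one intro: filt_mult)
    then show "a [^] (n choose Suc k) \<in> A s" for n .
    have pascal: "a [^] (Suc n choose Suc k) = a [^] (n choose k) \<otimes> a [^] (n choose Suc k)"
      "a [^] (Suc n choose Suc k) = a [^] (n choose Suc k) \<otimes> a [^] (n choose k)" for n
      using a by (simp_all add: nat_pow_mult add.commute)
    have "right_deriv (\<lambda>n. a [^] (n choose Suc k)) = (\<lambda>n. a [^] (n choose k))"
      unfolding right_deriv_def pascal(2) using a by simp
    moreover have "left_deriv (\<lambda>n. a [^] (n choose Suc k)) = (\<lambda>n. a [^] (n choose k))"
      unfolding left_deriv_def pascal(1) using a by (simp add: m_assoc)
    moreover have "polyseq (Suc s) (\<lambda>n. a [^] (n choose k))"
      using Suc.prems by (intro Suc.IH) simp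
    ultimately show "polyseq (Suc s) (right_deriv (\<lambda>n. a [^] (n choose Suc k)))"
      "polyseq (Suc s) (left_deriv (\<lambda>n. a [^] (n choose Suc k)))"
      by simp_all
  qed
qed

text \<open>If \<open>g\<close> is trivial below \<open>k\<close>, its \<open>k\<close>-fold right derivative has the value \<open>g k\<close> at \<open>0\<close>.\<close>

lemma polyseq_first_nontrivial:
  assumes "polyseq s g" "\<And>j. j < k \<Longrightarrow> g j = \<one>"
  shows "g k \<in> A (s + k)"
  using assms
proof (induction k arbitrary: s g)
  case 0
  then show ?case using polyseq_val by simp
next
  case (Suc k)
  have "right_deriv g j = \<one>" if "j < k" for j
    using Suc.prems(2)[of j] Suc.prems(2)[of "Suc j"] that by (simp add: right_deriv_def)
  then have "right_deriv g k \<in> A (Suc s + k)"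
    using Suc.IH polyseq_right_deriv[OF Suc.prems(1)] by blast
  moreover have "right_deriv g k = g (Suc k)"
    using Suc.prems polyseq_closed[OF Suc.prems(1)] by (simp add: right_deriv_def)
  ultimately show ?case by simp
qed

text \<open>
  This is the Taylor expansion of \<open>g\<close> in disguise: if \<open>g\<close> is trivial below \<open>k\<close>, then \<open>a = g k\<close> lies in
  \<open>A k\<close>, and dividing \<open>g\<close> by \<open>n \<mapsto> a\<close> to the \<open>n choose k\<close> leaves a polynomial sequence that is trivial
  up to \<open>k\<close>. The value at \<open>e\<close> is exhausted once \<open>k\<close> exceeds \<open>e\<close>.
\<close>

lemma polyseq_taylor:
  assumes S: "subgroup S G"
    and pow: "\<And>i a. m \<le> i \<Longrightarrow> a \<in> A i \<Longrightarrow> a [^] (e choose i) \<in> S"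
    and g: "polyseq 0 g" "\<And>j. j < m \<Longrightarrow> g j = \<one>"
  shows "g e \<in> S"
proof -
  interpret S: subgroup S G by (rule S)
  have claim: "\<forall>g. polyseq 0 g \<longrightarrow> (\<forall>j<k. g j = \<one>) \<longrightarrow> g e \<in> S"
    if "m \<le> k" "k \<le> max m (Suc e)" for k
    using that(2,1)
  proof (induction rule: inc_induct)
    case base
    then show ?case by (auto simp: S.one_closed less_max_iff_disj)
  next
    case (step k)
    show ?case
    proof (intro allI impI)
      fix g assume g: "polyseq 0 g" and vanish: "\<forall>j<k. g j = \<one>"
      let ?a = "g k"
      have a: "?a \<in> A k" using polyseq_first_nontrivial[OF g] vanish by simp
      have ac: "?a \<in> carrier G" using a by (rule filt_carrier)
      define h where "h n = inv ?a [^] (n choose k) \<otimes> g n" for n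
      have "polyseq 0 h"
        unfolding h_def using filt_inv[OF a] by (intro polyseq_mult polyseq_binomial g) simp
      moreover have "h j = \<one>" if "j < Suc k" for j
        using that vanish ac by (cases "j = k") (auto simp: h_def binomial_eq_0)
      ultimately have "h e \<in> S" using step by auto
      then have "?a [^] (e choose k) \<otimes> h e \<in> S"
        using pow[OF _ a] step by (intro S.m_closed) auto
      moreover have "?a [^] (e choose k) \<otimes> h e = g e"
        unfolding h_def nat_pow_inv[OF ac] using ac polyseq_closed[OF g] by simp
      ultimately show "g e \<in> S" by simp
    qed
  qed
  show ?thesis using claim[of m] g by simp
qed

text \<open>
  The correction factors of the classical formula are collected in a subgroup \<open>S\<close> known to contain them.
\<close>

lemma hall_petrescu:
  assumes S: "subgroup S G"
    and pow: "\<And>i c. 2 \<le> i \<Longrightarrow> c \<in> A i \<Longrightarrow> c [^] (e choose i) \<in> S"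
    and a: "a \<in> A 1" and b: "b \<in> A 1"
  shows "\<exists>t\<in>S. (a \<otimes> b) [^] e = a [^] e \<otimes> b [^] e \<otimes> t"
proof -
  note c = filt_carrier[OF a] filt_carrier[OF b]
  have powseq: "polyseq 0 (\<lambda>n. x [^] n)" if "x \<in> A 1" for x
    using polyseq_binomial[of x 0 1] that by simp
  let ?g = "\<lambda>n. inv b [^] n \<otimes> inv a [^] n \<otimes> (a \<otimes> b) [^] n"
  have "polyseq 0 ?g"
    by (intro polyseq_mult powseq filt_mult filt_inv a b)
  moreover have "?g j = \<one>" if "j < 2" for j :: nat
    using that c by (auto simp: less_2_cases_iff group_word_simps)
  ultimately have "?g e \<in> S" by (intro polyseq_taylor[where g = ?g and m = 2] S pow)
  moreover have "(a \<otimes> b) [^] e = a [^] e \<otimes> b [^] e \<otimes> ?g e"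
    using c by (simp add: nat_pow_inv group_word_simps)
  ultimately show ?thesis by blast
qed

end


section \<open>The lower central series\<close>

context group
begin

lemma commutator_subgroup_eq:
  "commutator_subgroup G H K = generate G {commutator h k | h k. h \<in> H \<and> k \<in> K}"
  unfolding commutator_subgroup_def commutator_def
  by (rule arg_cong[where f = "generate G"]) blast

lemma commutator_in_commutator_subgroup:
  "h \<in> H \<Longrightarrow> k \<in> K \<Longrightarrow> commutator h k \<in> commutator_subgroup G H K"
  unfolding commutator_subgroup_eq by (intro generate.incl) blast

lemma commutator_subgroup_mono:
  "H \<subseteq> H' \<Longrightarrow> commutator_subgroup G H K \<subseteq> commutator_subgroup G H' K"
  unfolding commutator_subgroup_eq by (intro mono_generate) blast

lemma commutator_subgroup_normal:
  assumes H: "H \<lhd> G"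
  shows "commutator_subgroup G H (carrier G) \<lhd> G"
  unfolding commutator_subgroup_eq
proof (rule normal_generateI)
  interpret H: normal H G by (rule H)
  note Hc = H.mem_carrier
  show "{commutator h k |h k. h \<in> H \<and> k \<in> carrier G} \<subseteq> carrier G"
    using Hc by auto
  fix x g assume "x \<in> {commutator h k |h k. h \<in> H \<and> k \<in> carrier G}" and g: "g \<in> carrier G"
  then obtain h k where hk: "h \<in> H" "k \<in> carrier G" "x = commutator h k" by blast
  have "g \<otimes> x \<otimes> inv g = commutator (g \<otimes> h \<otimes> inv g) (g \<otimes> k \<otimes> inv g)"
    unfolding hk(3) using hk(2) g Hc[OF hk(1)] by (simp add: group_word_simps)
  moreover have "g \<otimes> h \<otimes> inv g \<in> H" "g \<otimes> k \<otimes> inv g \<in> carrier G"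
    using H.inv_op_closed2[OF g hk(1)] g hk(2) by auto
  ultimately show "g \<otimes> x \<otimes> inv g \<in> {commutator h k |h k. h \<in> H \<and> k \<in> carrier G}" by blast
qed

lemma commutator_subgroup_subset:
  assumes H: "H \<lhd> G"
  shows "commutator_subgroup G H (carrier G) \<subseteq> H"
  unfolding commutator_subgroup_eq
proof (rule generate_subgroup_incl[OF _ normal_imp_subgroup[OF H]], clarify)
  interpret H: normal H G by (rule H)
  fix h k assume h: "h \<in> H" and k: "k \<in> carrier G"
  have "commutator h k = h \<otimes> (k \<otimes> inv h \<otimes> inv k)"
    using H.mem_carrier[OF h] k by (simp add: group_word_simps)
  then show "commutator h k \<in> H"
    using h H.inv_op_closed2[OF k H.m_inv_closed[OF h]] by simp
qed

lemma iter_commutator_normal: "H \<lhd> G \<Longrightarrow> iter_commutator G H m \<lhd> G"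
  by (induction m) (auto intro: commutator_subgroup_normal)

lemma iter_commutator_subset: "H \<lhd> G \<Longrightarrow> iter_commutator G H m \<subseteq> H"
  by (induction m) (use commutator_subgroup_subset iter_commutator_normal in force)+

lemma iter_commutator_mono: "H \<subseteq> K \<Longrightarrow> iter_commutator G H m \<subseteq> iter_commutator G K m"
  by (induction m) (auto dest: commutator_subgroup_mono)

lemma carrier_normal: "carrier G \<lhd> G"
  by (intro normal_invI subgroup_self) auto

lemma lower_central_normal: "lower_central G i \<lhd> G"
  unfolding lower_central_def by (intro iter_commutator_normal carrier_normal)

lemmas lower_central_subgroup = normal_imp_subgroup[OF lower_central_normal]

lemma lower_central_carrier: "x \<in> lower_central G i \<Longrightarrow> x \<in> carrier G"
  using lower_central_subgroup subgroup.subset by blast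

lemma lower_central_antimono:
  assumes "i \<le> j"
  shows "lower_central G j \<subseteq> lower_central G i"
proof (rule lift_Suc_antimono_le[of "lower_central G", OF _ assms])
  show "lower_central G (Suc n) \<subseteq> lower_central G n" for n
    using commutator_subgroup_subset[OF lower_central_normal[of n]]
    by (cases n) (auto simp: lower_central_Suc lower_central_def)
qed

lemma lower_central_add:
  assumes "i \<ge> 1"
  shows "lower_central G (i + m) = iter_commutator G (lower_central G i) m"
  using assms by (induction m) (auto simp: lower_central_Suc)

text \<open>
  The induction step is an instance of the three subgroups lemma. For \<open>w = [v, z]\<close> conjugation by \<open>x\<close>
  turns \<open>v\<close> into \<open>c v\<close> with \<open>c = [x, v]\<close>, and \<open>z\<close> into \<open>z d\<close> with \<open>d = [z\<^sup>-\<^sup>1, x]\<close>. Modulo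
  \<open>\<gamma>\<^bsub>i+j+1\<^esub>\<close> the element \<open>c\<close> is central and \<open>d\<close> commutes with \<open>v\<close>, hence \<open>[c v, z d] = [v, z]\<close>.
  Writing the second conjugate as \<open>d' z\<close> instead would require \<open>d'\<close> to commute with \<open>z\<close>.
\<close>

lemma lower_central_commutator:
  assumes "i \<ge> 1" "j \<ge> 1" "x \<in> lower_central G i" "y \<in> lower_central G j"
  shows "commutator x y \<in> lower_central G (i + j)"
  using assms(2,1,3,4)
proof (induction j arbitrary: i x y rule: nat_induct_at_least)
  case base
  then show ?case
    by (auto simp: lower_central_Suc intro: commutator_in_commutator_subgroup lower_central_carrier)
next
  case (Suc j)
  let ?M = "lower_central G (i + Suc j)"
  interpret M: normal ?M G by (rule lower_central_normal)
  have gen: "commutator x w \<in> ?M"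
    if x: "x \<in> lower_central G i"
      and w': "w \<in> {commutator v z |v z. v \<in> lower_central G j \<and> z \<in> carrier G}"
    for x w
  proof -
    obtain v z where w: "w = commutator v z" and v: "v \<in> lower_central G j" and z: "z \<in> carrier G"
      using w' by blast
    have xc: "x \<in> carrier G" and vc: "v \<in> carrier G" using x v lower_central_carrier by auto
    have comm1: "commutator a b \<in> lower_central G (Suc k)"
      if "k \<ge> 1" "a \<in> lower_central G k" "b \<in> carrier G" for a b k
      using that by (simp add: lower_central_Suc commutator_in_commutator_subgroup)
    let ?c = "commutator x v" and ?d = "commutator (inv z) x"
    have c: "?c \<in> lower_central G (i + j)" using Suc.IH Suc.prems(1) x v by blast
    have cc: "?c \<in> carrier G" using xc vc by simp
    have c_central: "commutator ?c b \<in> ?M" if "b \<in> carrier G" for b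
      using comm1[OF _ c that] Suc.prems(1) by simp
    have "commutator x (inv z) \<in> lower_central G (Suc i)"
      using comm1[OF Suc.prems(1) x] z by simp
    then have d: "?d \<in> lower_central G (Suc i)"
      using commutator_swap_in[OF lower_central_subgroup] xc z by simp
    have dc: "?d \<in> carrier G" using xc z by simp
    have dv: "commutator ?d (inv v) \<in> ?M"
      using Suc.IH[OF _ d subgroup.m_inv_closed[OF lower_central_subgroup v]] by simp
    let ?c' = "inv v \<otimes> inv ?c \<otimes> v"
    have c'c: "?c' \<in> carrier G" using cc vc by simp
    have c': "?c' \<in> lower_central G (i + j)"
      using normal.inv_op_closed1[OF lower_central_normal vc]
        subgroup.m_inv_closed[OF lower_central_subgroup c] by simp
    have "commutator ?c' ?d \<in> ?M"
      using comm1[OF _ c' dc] Suc.prems(1) by simp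
    then have dc': "commutator ?d ?c' \<in> ?M"
      by (rule commutator_swap_in[OF M.subgroup_axioms c'c dc])
    let ?w = "v \<otimes> z \<otimes> inv v" and ?vz = "v \<otimes> z"
    have wc: "?w \<in> carrier G" "?vz \<in> carrier G" using vc z by auto
    have "commutator x w = (?c \<otimes> (?vz \<otimes> commutator ?d ?c' \<otimes> inv ?vz) \<otimes> inv ?c) \<otimes>
        commutator ?c ?w \<otimes> (?vz \<otimes> commutator ?d (inv v) \<otimes> inv ?vz)"
      unfolding w using xc vc z by (simp add: group_word_simps)
    also have "\<dots> \<in> ?M"
      by (intro M.inv_op_closed2 M.m_closed c_central dc' dv wc cc)
    finally show ?thesis .
  qed
  have "y \<in> generate G {commutator v z |v z. v \<in> lower_central G j \<and> z \<in> carrier G}"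
    using Suc.prems(3) Suc.hyps by (simp add: lower_central_Suc commutator_subgroup_eq)
  then show ?case
    using Suc.prems(2) generate.incl[OF Suc.prems(2)]
    by (intro commutator_generate[OF M.normal_axioms _ _ gen]) (auto intro: lower_central_carrier)
qed

end


section \<open>Powers in the lower central series\<close>

lemma prime_power_dvd_choose:
  fixes p :: nat
  assumes p: "Factorial_Ring.prime p" and i: "0 < i" "i < p"
  shows "p ^ l dvd (p ^ l choose i)"
proof -
  obtain j where j: "i = Suc j" using i by (cases i) auto
  have "p ^ l > 0" using p by (simp add: prime_gt_0_nat)
  then obtain m where m: "p ^ l = Suc m" by (cases "p ^ l") auto
  have "i * (p ^ l choose i) = p ^ l * (m choose j)"
    unfolding m j by (metis mult.commute Suc_times_binomial_eq)
  then have "p ^ l dvd i * (p ^ l choose i)" by simp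
  moreover have "coprime (p ^ l) i"
    using p i by (intro coprime_power_left_iff[THEN iffD2] disjI1 prime_imp_coprime)
      (auto dest: dvd_imp_le)
  ultimately show ?thesis by (simp add: coprime_dvd_mult_right_iff)
qed

context group
begin

lemma nat_pow_mem_dvd:
  assumes S: "subgroup S G" and x: "x \<in> carrier G" "x [^] (e::nat) \<in> S" and d: "e dvd d"
  shows "x [^] d \<in> S"
proof -
  interpret S: subgroup S G by (rule S)
  obtain q where "d = e * q" using d by (elim dvdE)
  then have "x [^] d = (x [^] e) [^] q" using x by (simp add: nat_pow_pow)
  moreover have "(x [^] e) [^] q \<in> S"
    using x(2) by (induction q) (auto simp: S.one_closed S.m_closed)
  ultimately show ?thesis by simp
qed

text \<open>
  Although \<open>a\<close> lies only in \<open>\<gamma>\<^sub>k\<close>, no depth is lost: for \<open>A 1\<close> one takes the subgroup generated by \<open>a\<close>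
  and \<open>\<gamma>\<^bsub>k+1\<^esub>\<close>, whose commutators gain a step because it is cyclic modulo \<open>\<gamma>\<^bsub>k+1\<^esub>\<close>. This makes
  \<open>A i = \<gamma>\<^bsub>k+i\<^esub>\<close> a filtration (cut off at \<open>i = p\<close>), so that the \<open>i\<close>-th Hall--Petrescu factor lies
  in \<open>\<gamma>\<^bsub>k+i\<^esub>\<close>.
\<close>

lemma prime_power_mult:
  fixes p :: nat
  assumes p: "Factorial_Ring.prime p" and e: "e = p ^ l" and k: "k \<ge> 1" and S: "subgroup S G"
    and a: "a \<in> lower_central G k" and b: "b \<in> lower_central G (Suc k)"
    and pow: "\<And>j c. Suc k < j \<Longrightarrow> c \<in> lower_central G j \<Longrightarrow> c [^] e \<in> S"
    and top: "lower_central G (k + p) \<subseteq> S"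
  shows "\<exists>t\<in>S. (a \<otimes> b) [^] e = a [^] e \<otimes> b [^] e \<otimes> t"
proof -
  have p2: "p \<ge> 2" using p by (rule prime_ge_2_nat)
  let ?\<gamma> = "lower_central G"
  let ?B = "insert a (?\<gamma> (Suc k))"
  define A where "A i = (if i \<le> 1 then generate G ?B else ?\<gamma> (k + min i p))" for i
  have B: "?B \<subseteq> carrier G" using a lower_central_carrier by blast
  have A1: "generate G ?B \<subseteq> ?\<gamma> k"
    using a lower_central_antimono[of k "Suc k"]
    by (intro generate_subgroup_incl lower_central_subgroup) auto
  have comm: "commutator x y \<in> ?\<gamma> m"
    if "x \<in> ?\<gamma> i" "y \<in> ?\<gamma> j" "i \<ge> 1" "j \<ge> 1" "m \<le> i + j" for x y i j m
    using lower_central_commutator[OF that(3,4,1,2)] lower_central_antimono[OF that(5)] by blast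
  have A11: "commutator x y \<in> ?\<gamma> (Suc (Suc k))" if "x \<in> generate G ?B" "y \<in> generate G ?B" for x y
  proof (rule commutator_generate[OF lower_central_normal B B _ that])
    fix x y assume xy: "x \<in> ?B" "y \<in> ?B"
    have aa: "commutator a a \<in> ?\<gamma> (Suc (Suc k))"
      using a subgroup.one_closed[OF lower_central_subgroup]
      by (simp add: group_word_simps lower_central_carrier)
    show "commutator x y \<in> ?\<gamma> (Suc (Suc k))"
      using xy a k by (auto intro: aa comm[where m = "Suc (Suc k)" and i = k and j = "Suc k"]
        comm[where m = "Suc (Suc k)" and i = "Suc k" and j = k]
        comm[where m = "Suc (Suc k)" and i = "Suc k" and j = "Suc k"])
  qed
  interpret A: group_filtration G A p
  proof (rule group_filtration.intro[OF group_axioms], rule group_filtration_axioms.intro)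
    show "subgroup (A i) G" for i
      unfolding A_def using generate_is_subgroup[OF B] lower_central_subgroup by simp
    have "?\<gamma> (k + min (Suc i) p) \<subseteq> generate G ?B" if "i \<le> 1" "\<not> Suc i \<le> 1" for i
    proof -
      have "?\<gamma> (k + min (Suc i) p) \<subseteq> ?\<gamma> (Suc k)"
        using that p2 by (intro lower_central_antimono) auto
      then show ?thesis by (blast intro: generate.incl)
    qed
    moreover have "?\<gamma> (k + min (Suc i) p) \<subseteq> ?\<gamma> (k + min i p)" for i
      by (intro lower_central_antimono) simp
    ultimately show "A (Suc i) \<subseteq> A i" for i
      unfolding A_def by simp
    show "A i = A p" if "p \<le> i" for i
      using that p2 by (simp add: A_def)
    show "commutator x y \<in> A (i + j)" if x: "x \<in> A i" and y: "y \<in> A j" for x y i j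
    proof -
      consider "i \<le> 1" "j \<le> 1" | "i \<le> 1" "j \<ge> 2" | "i \<ge> 2" "j \<le> 1" | "i \<ge> 2" "j \<ge> 2"
        by linarith
      then show ?thesis
      proof cases
        case 1
        then have "commutator x y \<in> ?\<gamma> (Suc (Suc k))" using A11 x y by (simp add: A_def)
        moreover have "?\<gamma> (Suc (Suc k)) \<subseteq> ?\<gamma> (Suc k)" by (intro lower_central_antimono) simp
        ultimately have "commutator x y \<in> A 1" "commutator x y \<in> A 2"
          using p2 by (auto simp: A_def min_def intro: generate.incl)
        moreover have "A 1 = A (i + j) \<or> A 2 = A (i + j)"
          using 1 by (cases "i + j = 2") (auto simp: A_def)
        ultimately show ?thesis by auto
      next
        case 2
        then have "x \<in> ?\<gamma> k" "y \<in> ?\<gamma> (k + min j p)" using x y A1 by (auto simp: A_def)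
        then show ?thesis using 2 k by (auto simp: A_def intro!: comm)
      next
        case 3
        then have "x \<in> ?\<gamma> (k + min i p)" "y \<in> ?\<gamma> k" using x y A1 by (auto simp: A_def)
        then show ?thesis using 3 k by (auto simp: A_def intro!: comm)
      next
        case 4
        then have "x \<in> ?\<gamma> (k + min i p)" "y \<in> ?\<gamma> (k + min j p)" using x y by (auto simp: A_def)
        then show ?thesis using 4 k by (auto simp: A_def intro!: comm)
      qed
    qed
  qed
  have powA: "c [^] (e choose i) \<in> S" if i: "2 \<le> i" and c: "c \<in> A i" for i c
  proof (cases "i < p")
    case True
    then have c: "c \<in> ?\<gamma> (k + i)" using c i by (simp add: A_def)
    then have "c [^] e \<in> S" using i by (intro pow) auto
    moreover have "e dvd (e choose i)" unfolding e using p i True by (intro prime_power_dvd_choose) auto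
    ultimately show ?thesis using nat_pow_mem_dvd[OF S lower_central_carrier[OF c]] by blast
  next
    case False
    then have c: "c \<in> S" using c i top by (auto simp: A_def)
    then have "c [^] (1::nat) \<in> S" using subgroup.mem_carrier[OF S] by simp
    then show ?thesis using nat_pow_mem_dvd[OF S subgroup.mem_carrier[OF S c], of 1] by simp
  qed
  have "a \<in> A 1" "b \<in> A 1" using b by (auto simp: A_def intro: generate.incl)
  then show ?thesis by (intro A.hall_petrescu S powA)
qed

text \<open>
  The outer induction on \<open>m\<close> supplies \<open>u\<^sup>e \<in> R\<^sub>m\<close> for the shorter commutator \<open>u\<close>, the inner one all
  powers from deeper terms of the lower central series.
\<close>

proposition lower_central_pow_in_iter_commutator:
  fixes p :: nat
  assumes p: "Factorial_Ring.prime p" and e: "e = p ^ l" and R: "R \<lhd> G"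
    and nilp: "lower_central G p \<subseteq> R"
    and pow: "\<And>x. x \<in> carrier G \<Longrightarrow> x [^] e \<in> R"
    and mk: "m \<le> k" and w: "w \<in> lower_central G (Suc k)"
  shows "w [^] e \<in> iter_commutator G R m"
  using mk w
proof (induction m arbitrary: k w)
  case 0
  then show ?case using pow lower_central_carrier by simp
next
  case (Suc m)
  let ?\<gamma> = "lower_central G"
  define S where "S = iter_commutator G R (Suc m)"
  have commS: "commutator x y \<in> S" if "x \<in> iter_commutator G R m" "y \<in> carrier G" for x y
    using that by (simp add: S_def commutator_in_commutator_subgroup)
  interpret Rm: normal "iter_commutator G R m" G by (rule iter_commutator_normal[OF R])
  interpret S: normal S G unfolding S_def by (rule iter_commutator_normal[OF R])
  have top: "?\<gamma> j \<subseteq> S" if "p + Suc m \<le> j" for j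
    using lower_central_antimono[OF that] lower_central_add[of p "Suc m"]
      iter_commutator_mono[OF nilp, of "Suc m"] prime_gt_0_nat[OF p]
    unfolding S_def by auto
  have "w [^] e \<in> S" using Suc.prems
  proof (induction "p + Suc m - k" arbitrary: k w rule: less_induct)
    case less
    have k: "k \<ge> 1" using less.prems by simp
    show "w [^] e \<in> S"
    proof (cases "k < p + m")
      case False
      then have "w \<in> S" using top[of "Suc k"] less.prems by auto
      then have "w [^] (1::nat) \<in> S" using S.mem_carrier by simp
      then show ?thesis
        using nat_pow_mem_dvd[OF S.subgroup_axioms lower_central_carrier[OF less.prems(2)], of 1 e] by simp
    next
      case True
      \<comment> \<open>Powers from deeper terms of the series are covered by the downward induction.\<close>
      have higher: "c [^] e \<in> S" if "Suc k < j" "c \<in> ?\<gamma> j" for j c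
        using less.hyps[of "j - 1" c] that less.prems(1) True by simp
      have top': "?\<gamma> (k + p) \<subseteq> S" using top less.prems(1) by simp
      have mult: "\<exists>t\<in>S. (a \<otimes> b) [^] e = a [^] e \<otimes> b [^] e \<otimes> t"
        if "a \<in> ?\<gamma> k" "b \<in> ?\<gamma> (Suc k)" for a b
        by (intro prime_power_mult[OF p e k S.subgroup_axioms that _ top'] higher)
      have gen: "commutator v y \<in> ?\<gamma> (Suc k)" "commutator v y [^] e \<in> S"
        if v: "v \<in> ?\<gamma> k" and y: "y \<in> carrier G" for v y
      proof -
        \<comment> \<open>The inverse of \<open>v\<close> is chosen so that \<open>?u \<otimes> ?b\<close> is a conjugate of \<open>?u\<close>.\<close>
        let ?b = "commutator v y" and ?u = "inv v"
        have vc: "v \<in> carrier G" using v by (rule lower_central_carrier)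
        show b: "?b \<in> ?\<gamma> (Suc k)"
          using v y k by (simp add: lower_central_Suc commutator_in_commutator_subgroup)
        have u: "?u \<in> ?\<gamma> k" using v subgroup.m_inv_closed[OF lower_central_subgroup] by simp
        obtain t where t: "t \<in> S" "(?u \<otimes> ?b) [^] e = ?u [^] e \<otimes> ?b [^] e \<otimes> t"
          using mult[OF u b] by blast
        have tc: "t \<in> carrier G" using t(1) by (rule S.mem_carrier)
        let ?q = "?u [^] e"
        have qc: "?q \<in> carrier G" and bc: "?b [^] e \<in> carrier G" using vc y by simp_all
        have "?q \<in> iter_commutator G R m"
          using Suc.IH[of "k - 1" ?u] u k less.prems(1) by simp
        then have "commutator (inv ?q) y \<in> S"
          using y by (intro commS Rm.m_inv_closed)
        moreover have "?q \<otimes> ?b [^] e \<otimes> t = y \<otimes> ?q \<otimes> inv y"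
        proof -
          have "?u \<otimes> ?b = y \<otimes> ?u \<otimes> inv y"
            using vc y by (simp add: group_word_simps)
          then show ?thesis using t(2) conj_nat_pow[OF inv_closed[OF vc] y] by simp
        qed
        then have "inv ?q \<otimes> (?q \<otimes> (?b [^] e) \<otimes> t) \<otimes> inv t = inv ?q \<otimes> (y \<otimes> ?q \<otimes> inv y) \<otimes> inv t"
          by simp
        then have "?b [^] e = commutator (inv ?q) y \<otimes> inv t"
          using qc bc tc y by (simp add: m_assoc commutator_def[of "inv ?q"])
        ultimately show "?b [^] e \<in> S" using t(1) by simp
      qed
      have "w \<in> generate G {commutator v y |v y. v \<in> ?\<gamma> k \<and> y \<in> carrier G}"
        using less.prems(2) k by (simp add: lower_central_Suc commutator_subgroup_eq)
      then have "w \<in> ?\<gamma> (Suc k) \<and> w [^] e \<in> S"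
      proof (induction w rule: generate.induct)
        case one
        then show ?case
          using subgroup.one_closed[OF lower_central_subgroup] S.one_closed by simp
      next
        case (incl h)
        then show ?case using gen by blast
      next
        case (inv h)
        then have h: "h \<in> ?\<gamma> (Suc k)" "h [^] e \<in> S" using gen by blast+
        then show ?case
          using nat_pow_inv[OF lower_central_carrier[OF h(1)], of e]
            subgroup.m_inv_closed[OF lower_central_subgroup] S.m_inv_closed by simp
      next
        case (eng g h)
        then have "g \<in> ?\<gamma> k" using lower_central_antimono[of k "Suc k"] by auto
        then obtain t where t: "t \<in> S" "(g \<otimes> h) [^] e = g [^] e \<otimes> h [^] e \<otimes> t"
          using mult eng.IH by blast
        show ?case unfolding t(2)
          using eng.IH t(1) subgroup.m_closed[OF lower_central_subgroup] by (blast intro: S.m_closed)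
      qed
      then show ?thesis by blast
    qed
  qed
  then show ?case by (simp only: S_def)
qed

end

section \<open>Exponents and homomorphic images\<close>

lemma group_exponent_dvd:
  assumes "group H" and n: "n > 0" "\<And>h. h \<in> carrier H \<Longrightarrow> h [^]\<^bsub>H\<^esub> (n::nat) = \<one>\<^bsub>H\<^esub>"
  shows "group_exponent H dvd n"
    "h \<in> carrier H \<Longrightarrow> h [^]\<^bsub>H\<^esub> group_exponent H = \<one>\<^bsub>H\<^esub>"
proof -
  interpret H: group H by fact
  let ?P = "\<lambda>n::nat. n > 0 \<and> (\<forall>h\<in>carrier H. h [^]\<^bsub>H\<^esub> n = \<one>\<^bsub>H\<^esub>)"
  let ?e = "group_exponent H"
  have "?P n" using n by blast
  then have e: "?e = (LEAST n. ?P n)" unfolding group_exponent_def by (intro if_P exI)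
  have P: "?P ?e" unfolding e by (rule LeastI[of ?P, OF \<open>?P n\<close>])
  show pow: "h [^]\<^bsub>H\<^esub> ?e = \<one>\<^bsub>H\<^esub>" if "h \<in> carrier H" for h
    using P that by blast
  have mod: "h [^]\<^bsub>H\<^esub> (n mod ?e) = \<one>\<^bsub>H\<^esub>" if h: "h \<in> carrier H" for h
  proof -
    have "h [^]\<^bsub>H\<^esub> n = (h [^]\<^bsub>H\<^esub> ?e) [^]\<^bsub>H\<^esub> (n div ?e) \<otimes>\<^bsub>H\<^esub> h [^]\<^bsub>H\<^esub> (n mod ?e)"
      using h by (simp add: H.nat_pow_pow H.nat_pow_mult)
    then show ?thesis using n(2)[OF h] pow[OF h] h by simp
  qed
  have "n mod ?e < (LEAST n. ?P n)" using P by (simp flip: e)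
  then have "\<not> ?P (n mod ?e)" by (rule not_less_Least)
  then have "n mod ?e = 0" using mod by simp
  then show "?e dvd n" by (simp add: mod_eq_0_iff_dvd)
qed

lemma p_group_exponent:
  assumes p: "Factorial_Ring.prime p" and G: "finite_p_group p G"
  obtains l where "group_exponent G = p ^ l"
    "\<And>x. x \<in> carrier G \<Longrightarrow> x [^]\<^bsub>G\<^esub> group_exponent G = \<one>\<^bsub>G\<^esub>"
proof -
  interpret G: group G using G by (simp add: finite_p_group_def)
  obtain n where n: "order G = p ^ n" using G by (auto simp: finite_p_group_def)
  have "order G > 0" using n p by (simp add: prime_gt_0_nat)
  note exp = group_exponent_dvd[OF G.is_group this G.pow_order_eq_1]
  have "group_exponent G dvd p ^ n" using exp(1) n by simp
  then show thesis using that exp(2) p by (auto simp: divides_primepow_nat)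
qed

lemma hom_lower_central:
  assumes "group_hom G H f" and x: "x \<in> lower_central G i"
  shows "f x \<in> lower_central H i"
proof -
  interpret group_hom G H f by fact
  have "f x \<in> iter_commutator H (carrier H) m" if "x \<in> iter_commutator G (carrier G) m" for m x
    using that
  proof (induction m arbitrary: x)
    case (Suc m)
    let ?K = "iter_commutator G (carrier G) m" and ?L = "iter_commutator H (carrier H) m"
    have K: "?K \<subseteq> carrier G" by (rule G.iter_commutator_subset[OF G.carrier_normal])
    have N: "iter_commutator H (carrier H) (Suc m) \<lhd> H"
      by (rule H.iter_commutator_normal[OF H.carrier_normal])
    interpret N: normal "iter_commutator H (carrier H) (Suc m)" H by (rule N)
    have gen: "f (G.commutator h k) \<in> commutator_subgroup H ?L (carrier H)"
      if "h \<in> ?K" "k \<in> carrier G" for h k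
    proof -
      have "f (G.commutator h k) = H.commutator (f h) (f k)"
        using that K by (auto simp: G.commutator_def H.commutator_def subset_iff)
      then show ?thesis
        using that Suc.IH by (auto intro: H.commutator_in_commutator_subgroup)
    qed
    have U: "{G.commutator h k |h k. h \<in> ?K \<and> k \<in> carrier G} \<subseteq> carrier G"
      using K by auto
    have genU: "f h \<in> commutator_subgroup H ?L (carrier H)"
      if "h \<in> {G.commutator h k |h k. h \<in> ?K \<and> k \<in> carrier G}" for h
      using that gen by blast
    have "x \<in> generate G {G.commutator h k |h k. h \<in> ?K \<and> k \<in> carrier G}"
      using Suc.prems by (simp add: G.commutator_subgroup_eq)
    then have "f x \<in> iter_commutator H (carrier H) (Suc m)"
    proof (induction x rule: generate.induct)
      case one
      show ?case using N.one_closed by simp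
    next
      case (incl h)
      then show ?case using genU by simp
    next
      case (inv h)
      then have "f h \<in> iter_commutator H (carrier H) (Suc m)" "h \<in> carrier G"
        using genU U by auto
      then show ?case using N.m_inv_closed by simp
    next
      case (eng g h)
      then have "g \<in> carrier G" "h \<in> carrier G" using G.generate_in_carrier[OF U] by auto
      then show ?case using eng.IH N.m_closed by simp
    qed
    then show ?case .
  qed simp
  then show ?thesis using x unfolding lower_central_def by blast
qed

lemma nilpotency_class_lower_central:
  assumes "nilpotent_group G" "nilpotency_class G < i"
  shows "lower_central G i = {\<one>\<^bsub>G\<^esub>}"
proof -
  interpret group G using assms(1) by (simp add: nilpotent_group_def)
  obtain k where "lower_central G (k + 1) = {\<one>\<^bsub>G\<^esub>}"
    using assms(1) by (auto simp: nilpotent_group_def)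
  then have "lower_central G (nilpotency_class G + 1) = {\<one>\<^bsub>G\<^esub>}"
    unfolding nilpotency_class_def by (rule LeastI)
  moreover have "lower_central G i \<subseteq> lower_central G (nilpotency_class G + 1)"
    using assms(2) by (intro lower_central_antimono) simp
  ultimately show ?thesis
    using subgroup.one_closed[OF lower_central_subgroup[of i]] by auto
qed

section \<open>The exponent of the nilpotent multiplier\<close>

text \<open>
  The map \<open>F \<rightarrow> F/R \<rightarrow> G\<close> has kernel \<open>R\<close>, which translates the exponent and the class of \<open>G\<close> into
  statements about powers and the lower central series of \<open>F\<close>.
\<close>

lemma nilpotent_multiplier_exponent_dvd:
  fixes p :: nat
  assumes p: "Factorial_Ring.prime p"
    and G: "finite_p_group p G" "nilpotent_group G" "nilpotency_class G \<le> p - 1"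
    and F: "group F" "R \<lhd> F" "(F Mod R) \<cong> G"
  shows "group_exponent (nilpotent_multiplier F R c) dvd group_exponent G"
proof -
  interpret F: group F by fact
  interpret G: group G using G(1) by (simp add: finite_p_group_def)
  interpret R: normal R F by fact
  obtain l where e: "group_exponent G = p ^ l"
    and powG: "\<And>x. x \<in> carrier G \<Longrightarrow> x [^]\<^bsub>G\<^esub> group_exponent G = \<one>\<^bsub>G\<^esub>"
    using p_group_exponent[OF p G(1)] by blast
  let ?e = "group_exponent G"
  obtain \<phi> where \<phi>: "\<phi> \<in> iso (F Mod R) G" using F(3) by (auto simp: is_iso_def)
  interpret \<phi>: group_hom "F Mod R" G \<phi>
    using \<phi> R.factorgroup_is_group G.is_group
    by (simp add: group_hom_def group_hom_axioms_def iso_def)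
  define f where "f x = \<phi> (R #>\<^bsub>F\<^esub> x)" for x
  have f: "group_hom F G f"
    unfolding f_def using hom_compose[OF R.r_coset_hom_Mod \<phi>.homh]
    by (simp add: group_hom_def group_hom_axioms_def F.is_group G.is_group o_def)
  interpret f: group_hom F G f by (rule f)
  have ker: "x \<in> R" if x: "x \<in> carrier F" and fx: "f x = \<one>\<^bsub>G\<^esub>" for x
  proof -
    have "R #>\<^bsub>F\<^esub> x \<in> carrier (F Mod R)" using x by (auto simp: FactGroup_def RCOSETS_def)
    moreover have "\<one>\<^bsub>F Mod R\<^esub> \<in> carrier (F Mod R)" by (intro monoid.one_closed group.is_monoid R.factorgroup_is_group)
    moreover have "inj_on \<phi> (carrier (F Mod R))" using \<phi> by (simp add: iso_def bij_betw_def)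
    moreover have "\<phi> (R #>\<^bsub>F\<^esub> x) = \<phi> \<one>\<^bsub>F Mod R\<^esub>"
      using fx unfolding f_def \<phi>.hom_one .
    ultimately have "R #>\<^bsub>F\<^esub> x = \<one>\<^bsub>F Mod R\<^esub>" by (blast dest: inj_onD)
    then have "R #>\<^bsub>F\<^esub> x = R" by (simp add: FactGroup_def)
    then show ?thesis using F.rcos_self[OF x R.subgroup_axioms] by simp
  qed
  have powF: "x [^]\<^bsub>F\<^esub> ?e \<in> R" if "x \<in> carrier F" for x
    using that powG by (intro ker) (auto simp: f.hom_nat_pow)
  have "lower_central G p = {\<one>\<^bsub>G\<^esub>}"
    using prime_gt_0_nat[OF p] G by (intro nilpotency_class_lower_central) auto
  then have class_F: "lower_central F p \<subseteq> R"
    using hom_lower_central[OF f, of _ p] by (blast intro: ker F.lower_central_carrier)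
  let ?K = "R \<inter> lower_central F (c + 1)" and ?S = "iter_commutator F R c"
  have K: "subgroup ?K F"
    by (intro F.subgroups_Inter_pair R.subgroup_axioms F.lower_central_subgroup)
  have "?S \<subseteq> ?K"
    using F.iter_commutator_subset[OF F(2)] F.iter_commutator_mono[OF R.subset]
    by (auto simp: lower_central_def)
  then have S: "?S \<lhd> F\<lparr>carrier := ?K\<rparr>"
    by (intro F.normal_restrict_supergroup K F.iter_commutator_normal F(2))
  interpret S: normal ?S "F\<lparr>carrier := ?K\<rparr>" by (rule S)
  have M: "group (nilpotent_multiplier F R c)"
    unfolding nilpotent_multiplier_def by (rule S.factorgroup_is_group)
  have "h [^]\<^bsub>nilpotent_multiplier F R c\<^esub> ?e = \<one>\<^bsub>nilpotent_multiplier F R c\<^esub>"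
    if h: "h \<in> carrier (nilpotent_multiplier F R c)" for h
  proof -
    let ?FK = "F\<lparr>carrier := ?K\<rparr>"
    obtain x where x: "x \<in> ?K" and hx: "h = ?S #>\<^bsub>?FK\<^esub> x"
      using h by (auto simp: nilpotent_multiplier_def FactGroup_def RCOSETS_def)
    have "x [^]\<^bsub>F\<^esub> ?e \<in> ?S"
      using x by (intro F.lower_central_pow_in_iter_commutator[OF p e F(2) class_F powF le_refl]) simp_all
    moreover have pow_eq: "x [^]\<^bsub>?FK\<^esub> ?e = x [^]\<^bsub>F\<^esub> ?e"
      by (simp add: nat_pow_def)
    ultimately have "?S #>\<^bsub>?FK\<^esub> (x [^]\<^bsub>?FK\<^esub> ?e) = ?S"
      by (intro S.rcos_const S.is_group) simp
    then show ?thesis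
      unfolding nilpotent_multiplier_def hx using S.FactGroup_pow[of x ?e] x
      by (simp add: FactGroup_def)
  qed
  moreover have "?e > 0" unfolding e using p by (simp add: prime_gt_0_nat)
  ultimately show ?thesis using group_exponent_dvd(1)[OF M] by blast
qed

theorem corollary3p4:
  fixes p :: nat
    and G :: "('a, 'b) monoid_scheme"
    and F :: "('f, 'c) monoid_scheme"
    and R :: "'f set"
  assumes "Factorial_Ring.prime p"
    and "finite_p_group p G"
    and "nilpotent_group G"
    and "nilpotency_class G \<le> p - 1"
    and "free_presentation F R G"
  shows "(\<forall>c::nat. c \<ge> 1 \<longrightarrow>
            group_exponent (nilpotent_multiplier F R c) dvd group_exponent G) \<and>
         group_exponent (schur_multiplier F R) dvd group_exponent G"
  using assms nilpotent_multiplier_exponent_dvd[of p G F R]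
  unfolding schur_multiplier_def free_presentation_def is_free_group_def by blast

end
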